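(* Let $\mathcal T=(V,E,F)$ be an infinite, locally finite triangulation without boundary of a surface, with all vertex degrees bounded by a constant $M$, and let $d$ be a PL metric on $\mathcal T$ that is uniformly nondegenerate and uniformly Delaunay. Let $T>0$ and let $u(t),\hat u(t)$ be two solutions, for $t\in[0,T]$, of the combinatorial Yamabe flow $$\frac{\mathrm{d}u_i}{\mathrm{d}t}=-K_i(u(t)),\qquad u_i(0)=0,\qquad i\in V.$$ Suppose that the metrics $(su(t)+(1-s)\hat u(t))*d$ are PL metrics which are uniformly Delaunay for all $t\in[0,T]$ and $s\in[0,1]$, with a constant $\epsilon>0$ independent of $s$ and $t$. Then $u\equiv\hat u$ on $V\times[0,T]$.
   Context: $V,E,F$ are the sets of vertices, edges and (triangular) faces of the triangulation; without boundary means every edge lies in exactly two triangles. A PL metric on $\mathcal T$ is a function $l:E\to\mathbb R_{>0}$ such that for every triangle $\Delta ijk\in F$ the lengths $l_{ij},l_{ik},l_{jk}$ satisfy the (strict) triangle inequalities. For a PL metric, $\theta_i^{jk}$ denotes the inner angle at vertex $i$ of the Euclidean triangle $\Delta ijk$ with these edge lengths. For $u:V\to\mathbb R$, $u*d$ is the function on edges given by $(u*d)_{ij}=e^{\frac12(u_i+u_j)}d_{ij}$. When $u*d$ is a PL metric, $K_i(u)=2\pi-\sum_{\Delta ijk\in F}\theta_i^{jk}$, where the angles are those of $u*d$. A solution of the flow on $[0,T]$ is a function $u$, differentiable in $t$ at each vertex, such that $u(t)*d$ is a PL metric for every $t\in[0,T]$ and the equations hold. A PL metric $l$ is uniformly nondegenerate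 if there is a constant $\epsilon>0$ with $\theta_i^{jk}\ge\epsilon$ for every inner angle of every triangle $\Delta ijk\in F$. It is uniformly Delaunay (with constant $\epsilon>0$) if $\theta_{k_1}^{ij}+\theta_{k_2}^{ij}\le\pi-\epsilon$ for every pair of distinct triangles $\Delta ijk_1,\Delta ijk_2\in F$ sharing the edge $ij$ (i.e. the two angles opposite the common edge). *)

theory Defs
  imports "HOL-Analysis.Analysis"
begin

text \<open>
  A surface may have boundary here and need not be connected: charts take values in the closed
  half-plane. Boundary is excluded combinatorially, by \<open>without_boundary\<close> below.
\<close>

definition surface :: "'b topology \<Rightarrow> bool" where
  "surface S \<longleftrightarrow> Hausdorff_space S \<and> second_countable S \<and>
     (\<forall>p \<in> topspace S. \<exists>U W. openin S U \<and> p \<in> U \<and>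
        openin (top_of_set {z :: real^2. 0 \<le> z $ 2}) W \<and>
        subtopology S U homeomorphic_space top_of_set W)"

definition simplicial_2_complex :: "'a set \<Rightarrow> 'a set set \<Rightarrow> 'a set set \<Rightarrow> bool" where
  "simplicial_2_complex V E F \<longleftrightarrow>
     (\<forall>e\<in>E. e \<subseteq> V \<and> card e = 2) \<and>
     (\<forall>\<Delta>\<in>F. \<Delta> \<subseteq> V \<and> card \<Delta> = 3) \<and>
     (\<forall>\<Delta>\<in>F. \<forall>e. e \<subseteq> \<Delta> \<and> card e = 2 \<longrightarrow> e \<in> E)"

definition simplices :: "'a set \<Rightarrow> 'a set set \<Rightarrow> 'a set set \<Rightarrow> 'a set set" where
  "simplices V E F = (\<lambda>v. {v}) ` V \<union> E \<union> F"

text \<open>In barycentric coordinates; the topology used below is that of pointwise convergence.\<close>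

definition closed_simplex :: "'a set \<Rightarrow> ('a \<Rightarrow> real) set" where
  "closed_simplex \<sigma> = {x. (\<forall>v\<in>\<sigma>. 0 \<le> x v) \<and> (\<forall>v. v \<notin> \<sigma> \<longrightarrow> x v = 0) \<and> (\<Sum>v\<in>\<sigma>. x v) = 1}"

text \<open>The geometric realization carries the weak (coherent) topology.\<close>

definition realization :: "'a set \<Rightarrow> 'a set set \<Rightarrow> 'a set set \<Rightarrow> ('a \<Rightarrow> real) topology" where
  "realization V E F = topology (\<lambda>U.
     U \<subseteq> (\<Union>\<sigma>\<in>simplices V E F. closed_simplex \<sigma>) \<and>
     (\<forall>\<sigma>\<in>simplices V E F. openin (top_of_set (closed_simplex \<sigma>)) (U \<inter> closed_simplex \<sigma>)))"

lemma openin_realization: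
  "openin (realization V E F) U \<longleftrightarrow>
     U \<subseteq> (\<Union>\<sigma>\<in>simplices V E F. closed_simplex \<sigma>) \<and>
     (\<forall>\<sigma>\<in>simplices V E F. openin (top_of_set (closed_simplex \<sigma>)) (U \<inter> closed_simplex \<sigma>))"
proof -
  have "istopology (\<lambda>U.
     U \<subseteq> (\<Union>\<sigma>\<in>simplices V E F. closed_simplex \<sigma>) \<and>
     (\<forall>\<sigma>\<in>simplices V E F. openin (top_of_set (closed_simplex \<sigma>)) (U \<inter> closed_simplex \<sigma>)))"
    (is "istopology ?P")
    unfolding istopology_def
  proof (intro conjI allI impI)
    fix A B assume AB: "?P A" "?P B"
    have eq: "A \<inter> B \<inter> closed_simplex \<sigma> = (A \<inter> closed_simplex \<sigma>) \<inter> (B \<inter> closed_simplex \<sigma>)" for \<sigma>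
      by blast
    from AB show "A \<inter> B \<subseteq> (\<Union>\<sigma>\<in>simplices V E F. closed_simplex \<sigma>)"
      by blast
    from AB show "\<forall>\<sigma>\<in>simplices V E F.
        openin (top_of_set (closed_simplex \<sigma>)) (A \<inter> B \<inter> closed_simplex \<sigma>)"
      unfolding eq by blast
  next
    fix \<K> assume K: "\<forall>A\<in>\<K>. ?P A"
    then show "\<Union>\<K> \<subseteq> (\<Union>\<sigma>\<in>simplices V E F. closed_simplex \<sigma>)"
      by blast
    show "\<forall>\<sigma>\<in>simplices V E F. openin (top_of_set (closed_simplex \<sigma>)) (\<Union>\<K> \<inter> closed_simplex \<sigma>)"
      unfolding Int_Union2 using K by blast
  qed
  then show ?thesis
    unfolding realization_def by (simp add: topology_inverse')
qed

definition triangulation_of :: "'a set \<Rightarrow> 'a set set \<Rightarrow> 'a set set \<Rightarrow> 'b topology \<Rightarrow> bool" where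
  "triangulation_of V E F S \<longleftrightarrow>
     simplicial_2_complex V E F \<and> realization V E F homeomorphic_space S"

definition locally_finite :: "'a set \<Rightarrow> 'a set set \<Rightarrow> 'a set set \<Rightarrow> bool" where
  "locally_finite V E F \<longleftrightarrow> (\<forall>v\<in>V. finite {\<sigma> \<in> simplices V E F. v \<in> \<sigma>})"

definition without_boundary :: "'a set set \<Rightarrow> 'a set set \<Rightarrow> bool" where
  "without_boundary E F \<longleftrightarrow> (\<forall>e\<in>E. card {\<Delta>\<in>F. e \<subseteq> \<Delta>} = 2)"

definition vertex_degree :: "'a set set \<Rightarrow> 'a \<Rightarrow> nat" where
  "vertex_degree E i = card {e\<in>E. i \<in> e}"

text \<open>
  Functions on the edges are total functions on vertex sets; only their values on \<open>E\<close> matter.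
\<close>

definition PL_metric :: "'a set set \<Rightarrow> 'a set set \<Rightarrow> ('a set \<Rightarrow> real) \<Rightarrow> bool" where
  "PL_metric E F l \<longleftrightarrow>
     (\<forall>e\<in>E. 0 < l e) \<and>
     (\<forall>i j k. {i, j, k} \<in> F \<longrightarrow> l {i, j} < l {i, k} + l {j, k})"

text \<open>
  \<open>inner_angle l i {j, k}\<close> is $\theta_i^{jk}$, by the law of cosines;
  see \<open>inner_angle_law_of_cosines\<close> and \<open>inner_angle_euclidean\<close>.
\<close>

definition inner_angle :: "('a set \<Rightarrow> real) \<Rightarrow> 'a \<Rightarrow> 'a set \<Rightarrow> real" where
  "inner_angle l i e = arccos (((\<Sum>j\<in>e. (l {i, j})\<^sup>2) - (l e)\<^sup>2) / (2 * (\<Prod>j\<in>e. l {i, j})))"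

lemma inner_angle_law_of_cosines:
  assumes "j \<noteq> k"
  shows "inner_angle l i {j, k} =
    arccos (((l {i, j})\<^sup>2 + (l {i, k})\<^sup>2 - (l {j, k})\<^sup>2) / (2 * l {i, j} * l {i, k}))"
  using assms by (simp add: inner_angle_def mult.assoc)

lemma inner_angle_euclidean:
  fixes A B C :: "real^2"
  assumes "j \<noteq> k" "l {i, j} = dist A B" "l {i, k} = dist A C" "l {j, k} = dist B C"
  shows "inner_angle l i {j, k} = arccos (((B - A) \<bullet> (C - A)) / (norm (B - A) * norm (C - A)))"
proof -
  have "(dist A B)\<^sup>2 + (dist A C)\<^sup>2 - (dist B C)\<^sup>2 = 2 * ((B - A) \<bullet> (C - A))"
    by (simp add: dist_norm power2_norm_eq_inner inner_commute algebra_simps)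
  then show ?thesis
    using assms
    by (simp add: inner_angle_law_of_cosines dist_norm norm_minus_commute mult.assoc)
qed

definition uniformly_nondegenerate :: "'a set set \<Rightarrow> ('a set \<Rightarrow> real) \<Rightarrow> bool" where
  "uniformly_nondegenerate F l \<longleftrightarrow>
     (\<exists>\<epsilon>>0. \<forall>\<Delta>\<in>F. \<forall>i\<in>\<Delta>. \<epsilon> \<le> inner_angle l i (\<Delta> - {i}))"

definition uniformly_Delaunay :: "'a set set \<Rightarrow> ('a set \<Rightarrow> real) \<Rightarrow> real \<Rightarrow> bool" where
  "uniformly_Delaunay F l \<epsilon> \<longleftrightarrow>
     (\<forall>i j k1 k2. {i, j, k1} \<in> F \<and> {i, j, k2} \<in> F \<and> {i, j, k1} \<noteq> {i, j, k2} \<longrightarrow>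
        inner_angle l k1 {i, j} + inner_angle l k2 {i, j} \<le> pi - \<epsilon>)"

text \<open>On an edge \<open>e = {i, j}\<close> the sum in the exponent is \<open>u i + u j\<close>.\<close>

definition conformal_scale :: "('a \<Rightarrow> real) \<Rightarrow> ('a set \<Rightarrow> real) \<Rightarrow> 'a set \<Rightarrow> real"  (infixr "\<^bold>*" 75)
  where "(u \<^bold>* d) e = exp ((1 / 2) * (\<Sum>i\<in>e. u i)) * d e"

definition curvature :: "'a set set \<Rightarrow> ('a set \<Rightarrow> real) \<Rightarrow> 'a \<Rightarrow> real" where
  "curvature F l i = 2 * pi - (\<Sum>\<Delta> | \<Delta> \<in> F \<and> i \<in> \<Delta>. inner_angle l i (\<Delta> - {i}))"

definition yamabe_flow_solution ::
  "'a set \<Rightarrow> 'a set set \<Rightarrow> 'a set set \<Rightarrow> ('a set \<Rightarrow> real) \<Rightarrow> real \<Rightarrow> (real \<Rightarrow> 'a \<Rightarrow> real) \<Rightarrow> bool"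
  where
  "yamabe_flow_solution V E F d T u \<longleftrightarrow>
     (\<forall>i\<in>V. u 0 i = 0) \<and>
     (\<forall>t\<in>{0..T}. PL_metric E F (u t \<^bold>* d)) \<and>
     (\<forall>t\<in>{0..T}. \<forall>i\<in>V.
        ((\<lambda>\<tau>. u \<tau> i) has_real_derivative - curvature F (u t \<^bold>* d) i) (at t within {0..T}))"

end

theory Submission
  imports Defs
begin

text \<open>
  Uniqueness holds because, on the metrics that occur along the two solutions, the curvature
  depends on the conformal factor in a Lipschitz way for the supremum norm, with a constant independent of the vertex; the flow is then an ordinary
  differential equation with Lipschitz right-hand side in the bounded functions on \<open>V\<close>, and the
  Picard iteration bounds the difference of two solutions by
  \<open>B (C t)\<^sup>n / n!\<close> for every \<open>n\<close> (\<open>uniform_gronwall_zero\<close>).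

  The map from side lengths to angles is Lipschitz only away from degenerate triangles, so the
  point is a bound for all angles away from \<open>0\<close> and \<open>\<pi>\<close> that is uniform in the vertex and in time.
  As angles are nonnegative, the Delaunay condition keeps every single angle below \<open>\<pi> - \<epsilon>\<close>
  (\<open>Delaunay_inner_angle_le\<close>). A small angle must then come with a short opposite
  side, because a triangle with a small angle and comparable sides is nearly flat and has an angle
  near \<open>\<pi>\<close> (\<open>one_minus_cos_angle_ge\<close>). Side ratios within a triangle are bounded for \<open>d\<close> by
  nondegeneracy (\<open>nondegenerate_side_ratios\<close>), and they stay bounded along the flow: with bounded
  degree the curvature is bounded, so \<open>u\<close> is bounded on the whole of \<open>V \<times> [0, T]\<close>
  (\<open>yamabe_flow_bound\<close>).

  Cosines of angles are explicit in the conformal factor, and the admissible cosines form an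
  interval on which \<open>arccos\<close> is Lipschitz. Hence the angles of two metrics \<open>u * d\<close> and
  \<open>u' * d\<close> differ by at most a constant times \<open>sup \<bar>u - u'\<bar>\<close> (\<open>conformal_angle_lipschitz\<close>), and
  summing over the boundedly many faces at a vertex gives the estimate for the curvature.
\<close>

section \<open>Euclidean triangles\<close>

text \<open>The law of cosines for the angle enclosed by the sides \<open>a\<close> and \<open>b\<close>.\<close>

definition cos_angle :: "real \<Rightarrow> real \<Rightarrow> real \<Rightarrow> real" where
  "cos_angle a b c = (a\<^sup>2 + b\<^sup>2 - c\<^sup>2) / (2 * a * b)"

lemma one_minus_cos_angle:
  assumes "0 < a" "0 < b"
  shows "1 - cos_angle a b c = (c - a + b) * (c + a - b) / (2 * a * b)"
  using assms by (simp add: cos_angle_def field_simps power2_eq_square)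

lemma one_plus_cos_angle:
  assumes "0 < a" "0 < b"
  shows "1 + cos_angle a b c = (a + b - c) * (a + b + c) / (2 * a * b)"
  using assms by (simp add: cos_angle_def field_simps power2_eq_square)

lemma cos_angle_bounds:
  assumes "0 < a" "0 < b" "0 < c" "c < a + b" "a < b + c" "b < a + c"
  shows "-1 < cos_angle a b c" "cos_angle a b c < 1"
proof -
  have "0 < 1 + cos_angle a b c"
    using assms by (simp add: one_plus_cos_angle)
  then show "-1 < cos_angle a b c" by simp
  have "0 < 1 - cos_angle a b c"
    using assms by (simp add: one_minus_cos_angle)
  then show "cos_angle a b c < 1" by simp
qed

text \<open>
  The hypothesis on the angle between \<open>b\<close> and \<open>c\<close> gives \<open>2 \<eta> b c \<le> a\<^sup>2\<close>. If \<open>c\<close> is not much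
  smaller than \<open>b\<close> this bounds \<open>b\<close> by \<open>a\<close>; if it is, the triangle inequality does.
\<close>

lemma side_ratio_le:
  assumes pos: "0 < a" "0 < b" "0 < c" and tri: "b < a + c"
    and \<eta>: "0 < \<eta>" "\<eta> \<le> 2" "\<eta> \<le> 1 - cos_angle b c a"
  shows "b / a \<le> sqrt (8 / \<eta>)"
proof -
  have "1 - cos_angle b c a = (a\<^sup>2 - (b - c)\<^sup>2) / (2 * b * c)"
    using pos by (simp add: cos_angle_def field_simps power2_eq_square)
  then have "\<eta> * (2 * b * c) \<le> a\<^sup>2 - (b - c)\<^sup>2"
    using \<eta>(3) pos by (simp add: pos_le_divide_eq)
  moreover have "0 \<le> (b - c)\<^sup>2" by simp
  ultimately have a2: "\<eta> * (2 * b * c) \<le> a\<^sup>2" by linarith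
  have "\<eta> * b\<^sup>2 \<le> 8 * a\<^sup>2"
  proof (cases "b \<le> 2 * c")
    case True
    then have "\<eta> * (b * b) \<le> \<eta> * (b * (2 * c))"
      using pos \<eta> by (intro mult_left_mono) auto
    also have "\<dots> = \<eta> * (2 * b * c)" by simp
    also have "\<dots> \<le> 8 * a\<^sup>2" using a2 pos zero_le_power2[of a] by linarith
    finally show ?thesis by (simp add: power2_eq_square)
  next
    case False
    then have "b \<le> 2 * a" using tri by simp
    then have "b\<^sup>2 \<le> (2 * a)\<^sup>2" using pos by (intro power_mono) auto
    then have "\<eta> * b\<^sup>2 \<le> 2 * (2 * a)\<^sup>2"
      using \<eta> by (intro mult_mono) auto
    then show ?thesis by (simp add: power_mult_distrib)
  qed
  then have "(b / a)\<^sup>2 \<le> 8 / \<eta>"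
    using pos \<eta> by (simp add: field_simps)
  then show ?thesis by (rule real_le_rsqrt)
qed

text \<open>
  The two factors \<open>a + c - b\<close> and \<open>a + b - c\<close> of \<open>1 - cos_angle b c a\<close> also occur in
  \<open>1 + cos_angle a c b\<close> and \<open>1 + cos_angle a b c\<close>. Thus, if the sides \<open>b\<close> and \<open>c\<close> are at most
  \<open>R\<close> times the opposite side \<open>a\<close> and the other two angles stay away from \<open>\<pi>\<close>, this angle stays
  away from \<open>0\<close>.
\<close>

lemma one_minus_cos_angle_ge:
  assumes pos: "0 < a" "0 < b" "0 < c"
    and R: "0 \<le> R" "b / a \<le> R" "c / a \<le> R"
    and \<eta>: "0 \<le> \<eta>" "\<eta> \<le> 1 + cos_angle a c b" "\<eta> \<le> 1 + cos_angle a b c"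
  shows "2 * \<eta>\<^sup>2 / (1 + 2 * R)\<^sup>2 \<le> 1 - cos_angle b c a"
proof -
  let ?s = "a + b + c"
  have R1: "0 < 1 + 2 * R" using R by simp
  have s: "0 < ?s" "?s \<le> (1 + 2 * R) * a"
    using pos R by (auto simp: field_simps)
  have 1: "2 * a * c * \<eta> / ?s \<le> a + c - b"
    using \<eta>(2) pos by (simp add: one_plus_cos_angle field_simps)
  have 2: "2 * a * b * \<eta> / ?s \<le> a + b - c"
    using \<eta>(3) pos by (simp add: one_plus_cos_angle field_simps)
  have "2 * \<eta>\<^sup>2 / (1 + 2 * R)\<^sup>2 = 2 * \<eta>\<^sup>2 * a\<^sup>2 / ((1 + 2 * R) * a)\<^sup>2"
    using pos by (simp add: power_mult_distrib)
  also have "\<dots> \<le> 2 * \<eta>\<^sup>2 * a\<^sup>2 / ?s\<^sup>2"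
    using s pos by (intro divide_left_mono power_mono mult_pos_pos zero_less_power R1) auto
  also have "\<dots> = (2 * a * c * \<eta> / ?s) * (2 * a * b * \<eta> / ?s) / (2 * b * c)"
    using pos s(1) by (simp add: divide_simps power2_eq_square)
  also have "\<dots> \<le> (a + c - b) * (a + b - c) / (2 * b * c)"
  proof (intro divide_right_mono mult_mono)
    have "0 \<le> 2 * a * c * \<eta> / ?s" using pos \<eta> by simp
    then show "0 \<le> a + c - b" using 1 by (rule order_trans)
  qed (use 1 2 pos \<eta> in auto)
  also have "\<dots> = 1 - cos_angle b c a"
    using pos by (simp add: one_minus_cos_angle algebra_simps)
  finally show ?thesis .
qed

lemma arccos_lipschitz:
  assumes "0 < \<delta>" "\<bar>x\<bar> \<le> 1 - \<delta>" "\<bar>y\<bar> \<le> 1 - \<delta>"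
  shows "\<bar>arccos x - arccos y\<bar> \<le> 1 / sqrt (1 - (1 - \<delta>)\<^sup>2) * \<bar>x - y\<bar>"
proof -
  let ?I = "{-(1 - \<delta>)..1 - \<delta>}"
  have \<delta>: "\<delta> \<le> 1" using assms by linarith
  have "norm (arccos x - arccos y) \<le> 1 / sqrt (1 - (1 - \<delta>)\<^sup>2) * norm (x - y)"
  proof (rule field_differentiable_bound[where S = ?I])
    show "convex ?I" by simp
    show "x \<in> ?I" "y \<in> ?I" using assms by auto
    fix z assume z: "z \<in> ?I"
    then have z1: "-1 < z" "z < 1" using assms by auto
    show "(arccos has_field_derivative inverse (- sqrt (1 - z\<^sup>2))) (at z within ?I)"
      using DERIV_arccos[OF z1] by (rule has_field_derivative_at_within)
    have "z\<^sup>2 \<le> (1 - \<delta>)\<^sup>2"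
      using z \<delta> by (intro abs_le_square_iff[THEN iffD1]) auto
    moreover have "(1 - \<delta>)\<^sup>2 < 1"
      using assms \<delta> by (simp add: power2_eq_square algebra_simps abs_square_less_1)
    ultimately show "norm (inverse (- sqrt (1 - z\<^sup>2))) \<le> 1 / sqrt (1 - (1 - \<delta>)\<^sup>2)"
      by (auto simp: divide_simps)
  qed
  then show ?thesis by simp
qed

lemma exp_lipschitz:
  fixes x y :: real
  assumes "x \<le> m" "y \<le> m"
  shows "\<bar>exp x - exp y\<bar> \<le> exp m * \<bar>x - y\<bar>"
proof -
  have "norm (exp x - exp y) \<le> exp m * norm (x - y)"
    by (rule field_differentiable_bound[where S = "{..m}" and f' = exp])
      (use assms in \<open>auto intro: DERIV_exp has_field_derivative_at_within\<close>)
  then show ?thesis by simp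
qed

text \<open>
  Only ratios of the original sides and differences of the conformal factors enter; this is why
  bounded ratios and bounded factors give constants that do not depend on the triangle, although
  the side lengths themselves may be arbitrarily large or small.
\<close>

lemma cos_angle_conformal:
  assumes "0 < p" "0 < q"
  shows "cos_angle (exp ((x + y) / 2) * p) (exp ((x + z) / 2) * q) (exp ((y + z) / 2) * r) =
    (exp ((y - z) / 2) * (p / q) + exp ((z - y) / 2) * (q / p)
      - exp ((y + z) / 2 - x) * ((r / p) * (r / q))) / 2"
proof -
  define X Y Z where XYZ: "X = exp (x / 2)" "Y = exp (y / 2)" "Z = exp (z / 2)"
  have pos: "X > 0" "Y > 0" "Z > 0" by (simp_all add: XYZ)
  have "exp x = X * X" by (simp add: XYZ flip: exp_add)
  then have "exp ((x + y) / 2) = X * Y" "exp ((x + z) / 2) = X * Z" "exp ((y + z) / 2) = Y * Z"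
    "exp ((y - z) / 2) = Y / Z" "exp ((z - y) / 2) = Z / Y"
    "exp ((y + z) / 2 - x) = Y * Z / (X * X)"
    by (simp_all add: XYZ add_divide_distrib diff_divide_distrib exp_diff exp_add)
  note exps = this
  show ?thesis
    unfolding cos_angle_def exps
    using pos assms by (simp add: field_simps power2_eq_square)
qed

lemma cos_angle_conformal_lipschitz:
  assumes pos: "0 < p" "0 < q" "0 < r"
    and R: "p / q \<le> R" "q / p \<le> R" "r / p \<le> R" "r / q \<le> R"
    and N: "\<bar>x\<bar> \<le> N" "\<bar>y\<bar> \<le> N" "\<bar>z\<bar> \<le> N" "\<bar>x'\<bar> \<le> N" "\<bar>y'\<bar> \<le> N" "\<bar>z'\<bar> \<le> N"
    and D: "\<bar>x - x'\<bar> \<le> D" "\<bar>y - y'\<bar> \<le> D" "\<bar>z - z'\<bar> \<le> D"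
  shows "\<bar>cos_angle (exp ((x + y) / 2) * p) (exp ((x + z) / 2) * q) (exp ((y + z) / 2) * r) -
      cos_angle (exp ((x' + y') / 2) * p) (exp ((x' + z') / 2) * q) (exp ((y' + z') / 2) * r)\<bar>
    \<le> exp (2 * N) * (R + R\<^sup>2) * D"
proof -
  have R0: "0 \<le> R" using pos R(1) by (meson divide_nonneg_nonneg less_imp_le order_trans)
  have bound: "\<bar>exp a * m - exp b * m\<bar> \<le> exp (2 * N) * C * \<rho>"
    if "a \<le> 2 * N" "b \<le> 2 * N" "\<bar>a - b\<bar> \<le> C" "0 \<le> m" "m \<le> \<rho>" for a b m C \<rho>
  proof -
    have "\<bar>exp a * m - exp b * m\<bar> = \<bar>exp a - exp b\<bar> * m"
      using that by (simp add: abs_mult flip: left_diff_distrib)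
    also have "\<dots> \<le> (exp (2 * N) * C) * \<rho>"
    proof (intro mult_mono)
      have "\<bar>exp a - exp b\<bar> \<le> exp (2 * N) * \<bar>a - b\<bar>" using exp_lipschitz that by blast
      also have "\<dots> \<le> exp (2 * N) * C" using that by simp
      finally show "\<bar>exp a - exp b\<bar> \<le> exp (2 * N) * C" .
      show "0 \<le> exp (2 * N) * C" using that by simp
    qed (use that in auto)
    finally show ?thesis .
  qed
  have 1: "\<bar>exp ((y - z) / 2) * (p / q) - exp ((y' - z') / 2) * (p / q)\<bar>
      \<le> exp (2 * N) * D * R"
  proof (rule bound)
    show "(y - z) / 2 \<le> 2 * N" using N(2,3) unfolding diff_divide_distrib add_divide_distrib by linarith
    show "(y' - z') / 2 \<le> 2 * N" using N(5,6) unfolding diff_divide_distrib add_divide_distrib by linarith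
    show "\<bar>(y - z) / 2 - (y' - z') / 2\<bar> \<le> D" using D(2,3) unfolding diff_divide_distrib add_divide_distrib by linarith
  qed (use R pos in auto)
  have 2: "\<bar>exp ((z - y) / 2) * (q / p) - exp ((z' - y') / 2) * (q / p)\<bar>
      \<le> exp (2 * N) * D * R"
  proof (rule bound)
    show "(z - y) / 2 \<le> 2 * N" using N(2,3) unfolding diff_divide_distrib add_divide_distrib by linarith
    show "(z' - y') / 2 \<le> 2 * N" using N(5,6) unfolding diff_divide_distrib add_divide_distrib by linarith
    show "\<bar>(z - y) / 2 - (z' - y') / 2\<bar> \<le> D" using D(2,3) unfolding diff_divide_distrib add_divide_distrib by linarith
  qed (use R pos in auto)
  have rr: "(r / p) * (r / q) \<le> R\<^sup>2"
    unfolding power2_eq_square using R pos R0 by (intro mult_mono) auto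
  have 3: "\<bar>exp ((y + z) / 2 - x) * ((r / p) * (r / q)) -
      exp ((y' + z') / 2 - x') * ((r / p) * (r / q))\<bar> \<le> exp (2 * N) * (2 * D) * R\<^sup>2"
  proof (rule bound)
    show "(y + z) / 2 - x \<le> 2 * N" using N(1-3) unfolding diff_divide_distrib add_divide_distrib by linarith
    show "(y' + z') / 2 - x' \<le> 2 * N" using N(4-6) unfolding diff_divide_distrib add_divide_distrib by linarith
    show "\<bar>(y + z) / 2 - x - ((y' + z') / 2 - x')\<bar> \<le> 2 * D" using D unfolding diff_divide_distrib add_divide_distrib by linarith
  qed (use rr pos in auto)
  have half: "\<bar>(\<alpha> + \<beta> - \<gamma>) / 2 - (\<alpha>' + \<beta>' - \<gamma>') / 2\<bar> \<le> (A + B + C) / 2"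
    if "\<bar>\<alpha> - \<alpha>'\<bar> \<le> A" "\<bar>\<beta> - \<beta>'\<bar> \<le> B" "\<bar>\<gamma> - \<gamma>'\<bar> \<le> C" for \<alpha> \<beta> \<gamma> \<alpha>' \<beta>' \<gamma>' A B C :: real
    using that unfolding diff_divide_distrib add_divide_distrib by linarith
  show ?thesis
    unfolding cos_angle_conformal[OF pos(1,2)]
    by (rule order_trans[OF half[OF 1 2 3]]) (simp add: algebra_simps)
qed

section \<open>Faces of a triangulation\<close>

lemma faceE:
  assumes "simplicial_2_complex V E F" "\<Delta> \<in> F" "i \<in> \<Delta>"
  obtains j k where "\<Delta> = {i, j, k}" "\<Delta> - {i} = {j, k}"
proof -
  have "card \<Delta> = 3" using assms by (auto simp: simplicial_2_complex_def)
  then have "card (\<Delta> - {i}) = 2" using assms by simp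
  then obtain j k where "\<Delta> - {i} = {j, k}" by (auto simp: card_2_iff)
  moreover from this have "\<Delta> = {i, j, k}" using assms by auto
  ultimately show thesis using that by blast
qed

lemma face_distinct:
  assumes "simplicial_2_complex V E F" "{i, j, k} \<in> F"
  shows "i \<noteq> j" "i \<noteq> k" "j \<noteq> k"
proof -
  have "card {i, j, k} = 3" using assms by (auto simp: simplicial_2_complex_def)
  then show "i \<noteq> j" "i \<noteq> k" "j \<noteq> k" by (auto simp: card_insert_if split: if_splits)
qed

lemma face_edges:
  assumes "simplicial_2_complex V E F" "{i, j, k} \<in> F"
  shows "{i, j} \<in> E" "{i, k} \<in> E" "{j, k} \<in> E"
proof -
  note d = face_distinct[OF assms]
  have "e \<in> E" if "e \<subseteq> {i, j, k}" "card e = 2" for e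
    using assms that by (auto simp: simplicial_2_complex_def)
  then show "{i, j} \<in> E" "{i, k} \<in> E" "{j, k} \<in> E" using d by auto
qed

lemma face_vertices:
  assumes "simplicial_2_complex V E F" "{i, j, k} \<in> F"
  shows "i \<in> V" "j \<in> V" "k \<in> V"
  using assms by (auto simp: simplicial_2_complex_def)

text \<open>
  Every face at \<open>i\<close> contains an edge at \<open>i\<close>, and each of these edges lies in only two faces.
\<close>

lemma card_faces_at_vertex:
  assumes cplx: "simplicial_2_complex V E F" and lf: "locally_finite V E F"
    and wb: "without_boundary E F" and "i \<in> V" and deg: "vertex_degree E i \<le> M"
  shows "card {\<Delta> \<in> F. i \<in> \<Delta>} \<le> 2 * M"
proof -
  let ?E = "{e \<in> E. i \<in> e}" and ?F = "\<lambda>e. {\<Delta> \<in> F. e \<subseteq> \<Delta>}"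
  have fin: "finite {\<sigma> \<in> simplices V E F. i \<in> \<sigma>}"
    using lf \<open>i \<in> V\<close> by (auto simp: locally_finite_def)
  have finE: "finite ?E"
    by (rule finite_subset[OF _ fin]) (auto simp: simplices_def)
  have cardF: "card (?F e) = 2" if "e \<in> E" for e
    using wb that by (simp add: without_boundary_def)
  have finF: "finite (?F e)" if "e \<in> E" for e
    using cardF[OF that] by (intro card_ge_0_finite) simp
  have "{\<Delta> \<in> F. i \<in> \<Delta>} \<subseteq> (\<Union>e\<in>?E. ?F e)"
  proof
    fix \<Delta> assume "\<Delta> \<in> {\<Delta> \<in> F. i \<in> \<Delta>}"
    then have \<Delta>: "\<Delta> \<in> F" "i \<in> \<Delta>" by auto
    then obtain j k where jk: "\<Delta> = {i, j, k}" by (rule faceE[OF cplx])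
    then have "{i, j} \<in> E" using face_edges[OF cplx] \<Delta> by blast
    then show "\<Delta> \<in> (\<Union>e\<in>?E. ?F e)" using \<Delta> jk by blast
  qed
  then have "card {\<Delta> \<in> F. i \<in> \<Delta>} \<le> card (\<Union>e\<in>?E. ?F e)"
    using finE finF by (intro card_mono finite_UN_I) auto
  also have "\<dots> \<le> (\<Sum>e\<in>?E. card (?F e))" by (rule card_UN_le[OF finE])
  also have "\<dots> = 2 * card ?E" using cardF by simp
  also have "\<dots> \<le> 2 * M" using deg by (simp add: vertex_degree_def)
  finally show ?thesis .
qed

section \<open>Angles of PL metrics\<close>

lemma PL_metric_face:
  assumes cplx: "simplicial_2_complex V E F" and PL: "PL_metric E F l" and face: "{i, j, k} \<in> F"
  shows "0 < l {i, j}" "0 < l {i, k}" "0 < l {j, k}"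
    and "l {i, j} < l {i, k} + l {j, k}" "l {i, k} < l {i, j} + l {j, k}"
    and "l {j, k} < l {i, j} + l {i, k}"
proof -
  show "0 < l {i, j}" "0 < l {i, k}" "0 < l {j, k}"
    using PL face_edges[OF cplx face] by (auto simp: PL_metric_def)
  have tri: "l {x, y} < l {x, z} + l {y, z}" if "{x, y, z} \<in> F" for x y z
    using PL that by (auto simp: PL_metric_def)
  show "l {i, j} < l {i, k} + l {j, k}" using tri face by blast
  show "l {i, k} < l {i, j} + l {j, k}"
    using tri[of i k j] face by (simp add: insert_commute)
  show "l {j, k} < l {i, j} + l {i, k}"
    using tri[of j k i] face by (simp add: insert_commute)
qed

lemma inner_angle_eq_arccos:
  assumes "simplicial_2_complex V E F" "{i, j, k} \<in> F"
  shows "inner_angle l i {j, k} = arccos (cos_angle (l {i, j}) (l {i, k}) (l {j, k}))"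
  using face_distinct[OF assms] by (simp add: inner_angle_law_of_cosines cos_angle_def)

lemma cos_inner_angle:
  assumes "simplicial_2_complex V E F" "PL_metric E F l" "{i, j, k} \<in> F"
  shows "cos (inner_angle l i {j, k}) = cos_angle (l {i, j}) (l {i, k}) (l {j, k})"
  using cos_angle_bounds[of "l {i, j}" "l {i, k}" "l {j, k}"] PL_metric_face[OF assms]
  by (simp add: inner_angle_eq_arccos[OF assms(1,3)] cos_arccos)

lemma inner_angle_bounds:
  assumes "simplicial_2_complex V E F" "PL_metric E F l" "{i, j, k} \<in> F"
  shows "0 \<le> inner_angle l i {j, k}" "inner_angle l i {j, k} \<le> pi"
  using cos_angle_bounds[of "l {i, j}" "l {i, k}" "l {j, k}"] PL_metric_face[OF assms]
  by (simp_all add: inner_angle_eq_arccos[OF assms(1,3)] arccos_lbound arccos_ubound)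

text \<open>
  The edge \<open>jk\<close> has a second face, whose angle opposite to \<open>jk\<close> is nonnegative.
\<close>

lemma Delaunay_inner_angle_le:
  assumes cplx: "simplicial_2_complex V E F" and wb: "without_boundary E F"
    and PL: "PL_metric E F l" and Del: "uniformly_Delaunay F l \<epsilon>" and face: "{i, j, k} \<in> F"
  shows "inner_angle l i {j, k} \<le> pi - \<epsilon>"
proof -
  have "card {\<Delta> \<in> F. {j, k} \<subseteq> \<Delta>} = 2"
    using wb face_edges(3)[OF cplx face] unfolding without_boundary_def by blast
  moreover have "{i, j, k} \<in> {\<Delta> \<in> F. {j, k} \<subseteq> \<Delta>}"
    using face by blast
  ultimately have "\<exists>\<Delta>'\<in>{\<Delta> \<in> F. {j, k} \<subseteq> \<Delta>}. \<Delta>' \<noteq> {i, j, k}"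
    by (metis card_2_iff insertCI)
  then obtain \<Delta>' where \<Delta>': "\<Delta>' \<in> F" "{j, k} \<subseteq> \<Delta>'" "\<Delta>' \<noteq> {i, j, k}"
    by blast
  have "card (\<Delta>' - {j, k}) = 1"
    using \<Delta>' cplx face_distinct[OF cplx face]
    by (auto simp: simplicial_2_complex_def card_Diff_subset)
  then obtain i' where "\<Delta>' - {j, k} = {i'}" by (auto simp: card_1_singleton_iff)
  then have i': "\<Delta>' = {j, k, i'}" using \<Delta>' by auto
  then have "\<Delta>' = {i', j, k}" by auto
  then have face': "{i', j, k} \<in> F" "{i', j, k} \<noteq> {i, j, k}" using \<Delta>' by auto
  have rot: "{x, j, k} = {j, k, x}" for x by auto
  have "inner_angle l i {j, k} + inner_angle l i' {j, k} \<le> pi - \<epsilon>"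
    using Del face face' unfolding uniformly_Delaunay_def rot by blast
  moreover have "0 \<le> inner_angle l i' {j, k}"
    using inner_angle_bounds[OF cplx PL face'(1)] by simp
  ultimately show ?thesis by simp
qed

lemma Delaunay_one_plus_cos_angle_ge:
  assumes cplx: "simplicial_2_complex V E F" and wb: "without_boundary E F"
    and PL: "PL_metric E F l" and Del: "uniformly_Delaunay F l \<epsilon>" and "0 < \<epsilon>"
    and face: "{i, j, k} \<in> F"
  shows "1 - cos \<epsilon> \<le> 1 + cos_angle (l {i, j}) (l {i, k}) (l {j, k})"
proof -
  have "cos (pi - \<epsilon>) \<le> cos (inner_angle l i {j, k})"
    using Delaunay_inner_angle_le[OF cplx wb PL Del face] inner_angle_bounds[OF cplx PL face]
      \<open>0 < \<epsilon>\<close> by (intro cos_monotone_0_pi_le) auto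
  then show ?thesis by (simp add: cos_inner_angle[OF cplx PL face])
qed

lemma nondegenerate_side_ratios:
  assumes cplx: "simplicial_2_complex V E F" and PL: "PL_metric E F l"
    and nd: "uniformly_nondegenerate F l"
  obtains R where "\<And>i j k. {i, j, k} \<in> F \<Longrightarrow> l {i, j} / l {i, k} \<le> R"
proof -
  obtain \<epsilon> where \<epsilon>: "0 < \<epsilon>" and ge: "\<And>\<Delta> i. \<Delta> \<in> F \<Longrightarrow> i \<in> \<Delta> \<Longrightarrow> \<epsilon> \<le> inner_angle l i (\<Delta> - {i})"
    using nd by (auto simp: uniformly_nondegenerate_def)
  have "l {i, j} / l {i, k} \<le> sqrt (8 / (1 - cos \<epsilon>))" if face: "{i, j, k} \<in> F" for i j k
  proof -
    \<comment> \<open>The denominator cannot be small because the opposite angle, the one at \<open>j\<close>, is not.\<close>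
    have face': "{j, i, k} \<in> F" using face by (simp add: insert_commute)
    have "{i, j, k} - {j} = {i, k}" using face_distinct[OF cplx face] by auto
    then have ge: "\<epsilon> \<le> inner_angle l j {i, k}" using ge[OF face, of j] by simp
    also note inner_angle_bounds(2)[OF cplx PL face']
    finally have "\<epsilon> \<le> pi" .
    then have "cos \<epsilon> < cos 0" using \<epsilon> by (intro cos_monotone_0_pi) auto
    moreover have "cos (inner_angle l j {i, k}) \<le> cos \<epsilon>"
      using ge \<epsilon> inner_angle_bounds(2)[OF cplx PL face'] by (intro cos_monotone_0_pi_le) auto
    moreover have "-1 \<le> cos \<epsilon>" by simp
    ultimately show ?thesis
      using PL_metric_face[OF cplx PL face]
      by (intro side_ratio_le[where c = "l {j, k}"])
        (auto simp: cos_inner_angle[OF cplx PL face'] insert_commute)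
  qed
  then show thesis using that by blast
qed

lemma conformal_scale_edge: "j \<noteq> k \<Longrightarrow> (u \<^bold>* d) {j, k} = exp ((u j + u k) / 2) * d {j, k}"
  by (simp add: conformal_scale_def)

text \<open>
  Both metrics have their angles in one interval \<open>[\<alpha>, \<pi> - \<alpha>]\<close> with \<open>\<alpha> > 0\<close> determined by \<open>d\<close>,
  \<open>N\<close> and \<open>\<epsilon>\<close>. On the corresponding interval of cosines \<open>arccos\<close> is Lipschitz, and the cosines are
  Lipschitz in the conformal factor.
\<close>

lemma conformal_angle_lipschitz:
  assumes cplx: "simplicial_2_complex V E F" and wb: "without_boundary E F"
    and PLd: "PL_metric E F d" and nd: "uniformly_nondegenerate F d" and \<epsilon>: "0 < \<epsilon>"
  obtains L where "0 \<le> L"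
    and "\<And>u u' D i j k. \<lbrakk>{i, j, k} \<in> F;
      PL_metric E F (u \<^bold>* d); uniformly_Delaunay F (u \<^bold>* d) \<epsilon>; \<And>v. v \<in> V \<Longrightarrow> \<bar>u v\<bar> \<le> N;
      PL_metric E F (u' \<^bold>* d); uniformly_Delaunay F (u' \<^bold>* d) \<epsilon>; \<And>v. v \<in> V \<Longrightarrow> \<bar>u' v\<bar> \<le> N;
      \<And>v. v \<in> V \<Longrightarrow> \<bar>u v - u' v\<bar> \<le> D\<rbrakk> \<Longrightarrow>
      \<bar>inner_angle (u \<^bold>* d) i {j, k} - inner_angle (u' \<^bold>* d) i {j, k}\<bar> \<le> L * D"
proof -
  obtain R0 where R0: "\<And>i j k. {i, j, k} \<in> F \<Longrightarrow> d {i, j} / d {i, k} \<le> R0"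
    using nondegenerate_side_ratios[OF cplx PLd nd] by blast
  define R where "R = max 0 R0"
  have R: "0 \<le> R" "\<And>i j k. {i, j, k} \<in> F \<Longrightarrow> d {i, j} / d {i, k} \<le> R"
    using R0 by (auto simp: R_def le_max_iff_disj)
  \<comment> \<open>\<open>R'\<close> bounds the side ratios of the rescaled metrics, and the angles of these metrics have
    their cosines in \<open>[\<delta> - 1, 1 - \<delta>]\<close>.\<close>
  define R' where "R' = exp N * R"
  have R': "0 \<le> R'" using R by (simp add: R'_def)
  define \<eta> where "\<eta> = 1 - cos \<epsilon>"
  define \<delta> where "\<delta> = min \<eta> (2 * \<eta>\<^sup>2 / (1 + 2 * R')\<^sup>2)"
  define A where "A = 1 / sqrt (1 - (1 - \<delta>)\<^sup>2)"
  define B where "B = exp (2 * N) * (R + R\<^sup>2)"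
  have "0 \<le> B" using R by (simp add: B_def)

  have cos_bound: "\<bar>cos_angle ((u \<^bold>* d) {i, j}) ((u \<^bold>* d) {i, k}) ((u \<^bold>* d) {j, k})\<bar> \<le> 1 - \<delta>
      \<and> 0 < \<delta>"
    if face: "{i, j, k} \<in> F" and PL: "PL_metric E F (u \<^bold>* d)"
      and Del: "uniformly_Delaunay F (u \<^bold>* d) \<epsilon>" and N: "\<And>v. v \<in> V \<Longrightarrow> \<bar>u v\<bar> \<le> N"
    for u i j k
  proof -
    let ?l = "u \<^bold>* d"
    have faces: "{j, i, k} \<in> F" "{k, i, j} \<in> F" "{j, k, i} \<in> F" "{k, j, i} \<in> F"
      using face by (simp_all add: insert_commute)
    \<comment> \<open>That \<open>\<delta>\<close> is positive needs a face: its angles lie between \<open>0\<close> and \<open>\<pi> - \<epsilon>\<close>, so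
      \<open>\<epsilon> \<le> \<pi>\<close> and \<open>cos \<epsilon> < 1\<close>.\<close>
    have "\<epsilon> \<le> pi"
      using Delaunay_inner_angle_le[OF cplx wb PL Del face] inner_angle_bounds[OF cplx PL face]
      by simp
    then have "cos \<epsilon> < cos 0" using \<epsilon> by (intro cos_monotone_0_pi) auto
    then have \<eta>: "0 < \<eta>" by (simp add: \<eta>_def)
    then have \<delta>: "0 < \<delta>" using R' by (auto simp: \<delta>_def)
    have ratio: "?l {x, y} / ?l {x, z} \<le> R'" if f: "{x, y, z} \<in> F" for x y z
    proof -
      note dd = face_distinct[OF cplx f] and v = face_vertices[OF cplx f]
      have "?l {x, y} / ?l {x, z} = exp ((u x + u y) / 2 - (u x + u z) / 2) * (d {x, y} / d {x, z})"
        using dd by (simp add: conformal_scale_edge exp_diff)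
      also have "\<dots> \<le> R'" unfolding R'_def
      proof (intro mult_mono)
        have "\<bar>u y\<bar> \<le> N" "\<bar>u z\<bar> \<le> N" using N v by auto
        then have "(u x + u y) / 2 - (u x + u z) / 2 \<le> N" by (simp add: field_simps abs_le_iff)
        then show "exp ((u x + u y) / 2 - (u x + u z) / 2) \<le> exp N" by simp
      qed (use R PL_metric_face[OF cplx PLd f] f in auto)
      finally show ?thesis .
    qed
    have "2 * \<eta>\<^sup>2 / (1 + 2 * R')\<^sup>2 \<le> 1 - cos_angle (?l {i, j}) (?l {i, k}) (?l {j, k})"
    proof (rule one_minus_cos_angle_ge)
      show "?l {i, j} / ?l {j, k} \<le> R'"
        using ratio[of j i k] faces by (simp add: insert_commute)
      show "?l {i, k} / ?l {j, k} \<le> R'" using ratio[of k i j] faces by (simp add: insert_commute)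
      show "\<eta> \<le> 1 + cos_angle (?l {j, k}) (?l {i, k}) (?l {i, j})"
        using Delaunay_one_plus_cos_angle_ge[OF cplx wb PL Del \<epsilon> faces(4)]
        by (simp add: \<eta>_def insert_commute)
      show "\<eta> \<le> 1 + cos_angle (?l {j, k}) (?l {i, j}) (?l {i, k})"
        using Delaunay_one_plus_cos_angle_ge[OF cplx wb PL Del \<epsilon> faces(3)]
        by (simp add: \<eta>_def insert_commute)
    qed (use PL_metric_face[OF cplx PL face] \<eta> R' in auto)
    moreover have "\<eta> \<le> 1 + cos_angle (?l {i, j}) (?l {i, k}) (?l {j, k})"
      using Delaunay_one_plus_cos_angle_ge[OF cplx wb PL Del \<epsilon> face] by (simp add: \<eta>_def)
    moreover have "\<delta> \<le> \<eta>" "\<delta> \<le> 2 * \<eta>\<^sup>2 / (1 + 2 * R')\<^sup>2" by (simp_all add: \<delta>_def)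
    ultimately show ?thesis using \<delta> by linarith
  qed

  show thesis
  proof (rule that)
    show "0 \<le> \<bar>A\<bar> * B" using \<open>0 \<le> B\<close> by simp
    fix u u' D i j k
    assume face: "{i, j, k} \<in> F"
      and u: "PL_metric E F (u \<^bold>* d)" "uniformly_Delaunay F (u \<^bold>* d) \<epsilon>" "\<And>v. v \<in> V \<Longrightarrow> \<bar>u v\<bar> \<le> N"
      and u': "PL_metric E F (u' \<^bold>* d)" "uniformly_Delaunay F (u' \<^bold>* d) \<epsilon>" "\<And>v. v \<in> V \<Longrightarrow> \<bar>u' v\<bar> \<le> N"
      and D: "\<And>v. v \<in> V \<Longrightarrow> \<bar>u v - u' v\<bar> \<le> D"
    let ?c = "\<lambda>u. cos_angle ((u \<^bold>* d) {i, j}) ((u \<^bold>* d) {i, k}) ((u \<^bold>* d) {j, k})"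
    note dist = face_distinct[OF cplx face] and v = face_vertices[OF cplx face]
    have faces: "{i, k, j} \<in> F" "{j, k, i} \<in> F" "{k, j, i} \<in> F"
      using face by (simp_all add: insert_commute)
    have c: "\<bar>?c u - ?c u'\<bar> \<le> B * D"
      unfolding B_def conformal_scale_edge[OF dist(1)] conformal_scale_edge[OF dist(2)]
        conformal_scale_edge[OF dist(3)]
    proof (rule cos_angle_conformal_lipschitz)
      show "0 < d {i, j}" "0 < d {i, k}" "0 < d {j, k}" using PL_metric_face[OF cplx PLd face] by auto
      show "d {i, j} / d {i, k} \<le> R" "d {i, k} / d {i, j} \<le> R"
        using R(2) face faces by auto
      show "d {j, k} / d {i, j} \<le> R" "d {j, k} / d {i, k} \<le> R"
        using R(2)[OF faces(2)] R(2)[OF faces(3)] by (simp_all add: insert_commute)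
    qed (use u u' v D in auto)
    have "\<bar>inner_angle (u \<^bold>* d) i {j, k} - inner_angle (u' \<^bold>* d) i {j, k}\<bar> \<le> A * \<bar>?c u - ?c u'\<bar>"
      unfolding inner_angle_eq_arccos[OF cplx face] A_def
      using cos_bound[OF face u] cos_bound[OF face u'] by (intro arccos_lipschitz) auto
    also have "\<dots> \<le> \<bar>A\<bar> * (B * D)" using c by (intro mult_mono) auto
    finally show "\<bar>inner_angle (u \<^bold>* d) i {j, k} - inner_angle (u' \<^bold>* d) i {j, k}\<bar> \<le> \<bar>A\<bar> * B * D"
      by simp
  qed
qed

section \<open>Curvature\<close>

lemma curvature_bound:
  assumes cplx: "simplicial_2_complex V E F" and PL: "PL_metric E F l"
    and card: "card {\<Delta> \<in> F. i \<in> \<Delta>} \<le> n"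
  shows "\<bar>curvature F l i\<bar> \<le> 2 * pi + n * pi"
proof -
  have ang: "\<bar>inner_angle l i (\<Delta> - {i})\<bar> \<le> pi" if "\<Delta> \<in> {\<Delta> \<in> F. i \<in> \<Delta>}" for \<Delta>
  proof -
    obtain j k where jk: "\<Delta> = {i, j, k}" "\<Delta> - {i} = {j, k}"
      using \<open>\<Delta> \<in> _\<close> faceE[OF cplx, of \<Delta> i] by blast
    have "0 \<le> inner_angle l i {j, k} \<and> inner_angle l i {j, k} \<le> pi"
      using inner_angle_bounds[OF cplx PL] that jk by blast
    then show ?thesis by (simp add: jk(2))
  qed
  have "\<bar>\<Sum>\<Delta> | \<Delta> \<in> F \<and> i \<in> \<Delta>. inner_angle l i (\<Delta> - {i})\<bar>
      \<le> (\<Sum>\<Delta> | \<Delta> \<in> F \<and> i \<in> \<Delta>. \<bar>inner_angle l i (\<Delta> - {i})\<bar>)"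
    by (rule sum_abs)
  also have "\<dots> \<le> card {\<Delta> \<in> F. i \<in> \<Delta>} * pi"
    using ang by (intro sum_bounded_above)
  also have "\<dots> \<le> n * pi" using card by (intro mult_right_mono) auto
  finally have "\<bar>\<Sum>\<Delta> | \<Delta> \<in> F \<and> i \<in> \<Delta>. inner_angle l i (\<Delta> - {i})\<bar> \<le> n * pi" .
  then show ?thesis unfolding curvature_def using pi_gt_zero by linarith
qed

lemma curvature_diff_le:
  assumes cplx: "simplicial_2_complex V E F"
    and card: "card {\<Delta> \<in> F. i \<in> \<Delta>} \<le> n" and "0 \<le> C"
    and ang: "\<And>j k. {i, j, k} \<in> F \<Longrightarrow> \<bar>inner_angle l i {j, k} - inner_angle l' i {j, k}\<bar> \<le> C"
  shows "\<bar>curvature F l i - curvature F l' i\<bar> \<le> n * C"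
proof -
  have *: "\<bar>inner_angle l i (\<Delta> - {i}) - inner_angle l' i (\<Delta> - {i})\<bar> \<le> C"
    if "\<Delta> \<in> {\<Delta> \<in> F. i \<in> \<Delta>}" for \<Delta>
  proof -
    obtain j k where jk: "\<Delta> = {i, j, k}" "\<Delta> - {i} = {j, k}"
      using \<open>\<Delta> \<in> _\<close> faceE[OF cplx, of \<Delta> i] by blast
    then have "{i, j, k} \<in> F" using that by auto
    then show ?thesis using ang[of j k] by (simp add: jk(2))
  qed
  have "\<bar>curvature F l i - curvature F l' i\<bar> =
      \<bar>\<Sum>\<Delta> | \<Delta> \<in> F \<and> i \<in> \<Delta>. inner_angle l i (\<Delta> - {i}) - inner_angle l' i (\<Delta> - {i})\<bar>"
    by (simp add: curvature_def sum_subtractf)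
  also have "\<dots> \<le> (\<Sum>\<Delta> | \<Delta> \<in> F \<and> i \<in> \<Delta>. \<bar>inner_angle l i (\<Delta> - {i}) - inner_angle l' i (\<Delta> - {i})\<bar>)"
    by (rule sum_abs)
  also have "\<dots> \<le> card {\<Delta> \<in> F. i \<in> \<Delta>} * C"
    using * by (intro sum_bounded_above)
  also have "\<dots> \<le> n * C" using card \<open>0 \<le> C\<close> by (intro mult_right_mono) auto
  finally show ?thesis .
qed

section \<open>Differential inequalities\<close>

lemma abs_le_of_derivative_bound:
  fixes f f' g g' :: "real \<Rightarrow> real"
  assumes f: "\<And>t. t \<in> {0..T} \<Longrightarrow> (f has_real_derivative f' t) (at t within {0..T})"
    and g: "\<And>t. t \<in> {0..T} \<Longrightarrow> (g has_real_derivative g' t) (at t within {0..T})"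
    and le: "\<And>t. t \<in> {0..T} \<Longrightarrow> \<bar>f' t\<bar> \<le> g' t"
    and "f 0 = 0" "g 0 = 0" and t: "t \<in> {0..T}"
  shows "\<bar>f t\<bar> \<le> g t"
proof -
  have mono: "h 0 \<le> h t"
    if "\<And>s. s \<in> {0..T} \<Longrightarrow> (h has_real_derivative h' s) (at s within {0..T})"
      "\<And>s. s \<in> {0..T} \<Longrightarrow> 0 \<le> h' s" for h h' :: "real \<Rightarrow> real"
  proof (rule DERIV_nonneg_imp_increasing_open[of 0 t h])
    show "0 \<le> t" using t by simp
    show "\<exists>y. DERIV h x :> y \<and> 0 \<le> y" if "0 < x" "x < t" for x
    proof -
      have "x \<in> interior {0..T}" using that t by simp
      then have "at x within {0..T} = at x" by (rule at_within_interior)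
      then show ?thesis using that t \<open>\<And>s. s \<in> {0..T} \<Longrightarrow> (h has_real_derivative h' s) _\<close>[of x]
          \<open>\<And>s. s \<in> {0..T} \<Longrightarrow> 0 \<le> h' s\<close>[of x] by auto
    qed
    have "continuous_on {0..T} h"
      using that(1) by (meson DERIV_continuous continuous_on_eq_continuous_within)
    then show "continuous_on {0..t} h" by (rule continuous_on_subset) (use t in auto)
  qed
  have le': "f' s \<le> g' s" "- f' s \<le> g' s" if "s \<in> {0..T}" for s
    using le[OF that] by (auto simp: abs_le_iff)
  have "g 0 - f 0 \<le> g t - f t"
  proof (rule mono[where h' = "\<lambda>t. g' t - f' t"])
    show "0 \<le> g' s - f' s" if "s \<in> {0..T}" for s using le'[OF that] by linarith
  qed (intro DERIV_diff f g)
  moreover have "g 0 + f 0 \<le> g t + f t"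
  proof (rule mono[where h' = "\<lambda>t. g' t + f' t"])
    show "0 \<le> g' s + f' s" if "s \<in> {0..T}" for s using le'[OF that] by linarith
  qed (intro DERIV_add f g)
  ultimately show ?thesis using assms by (simp add: abs_le_iff)
qed

text \<open>
  Picard iteration in the bounded functions on \<open>I\<close>: integrating the estimate \<open>\<bar>w\<bar> \<le> B (C t)\<^sup>n / n!\<close>
  once more gives the same estimate for \<open>n + 1\<close>. Arguing with pointwise bounds rather than with
  the function \<open>t \<mapsto> sup \<bar>w t i\<bar>\<close> avoids its continuity, which is not clear for infinite \<open>I\<close>.
\<close>

lemma uniform_gronwall_zero:
  fixes w w' :: "real \<Rightarrow> 'a \<Rightarrow> real"
  assumes deriv: "\<And>i t. i \<in> I \<Longrightarrow> t \<in> {0..T} \<Longrightarrow>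
      ((\<lambda>\<tau>. w \<tau> i) has_real_derivative w' t i) (at t within {0..T})"
    and init: "\<And>i. i \<in> I \<Longrightarrow> w 0 i = 0"
    and bdd: "\<And>i t. i \<in> I \<Longrightarrow> t \<in> {0..T} \<Longrightarrow> \<bar>w t i\<bar> \<le> B"
    and lip: "\<And>i t D. i \<in> I \<Longrightarrow> t \<in> {0..T} \<Longrightarrow> (\<And>j. j \<in> I \<Longrightarrow> \<bar>w t j\<bar> \<le> D) \<Longrightarrow> \<bar>w' t i\<bar> \<le> C * D"
    and "i \<in> I" "t \<in> {0..T}"
  shows "w t i = 0"
proof -
  have iter: "\<bar>w t i\<bar> \<le> B * (C * t) ^ n / fact n" if "i \<in> I" "t \<in> {0..T}" for n i t
    using that
  proof (induction n arbitrary: i t)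
    case 0
    then show ?case using bdd by simp
  next
    case (Suc n)
    show ?case
    proof (rule abs_le_of_derivative_bound[where f' = "\<lambda>t. w' t i" and T = T
          and g = "\<lambda>t. B * (C * t) ^ Suc n / fact (Suc n)"
          and g' = "\<lambda>t. C * (B * (C * t) ^ n / fact n)"])
      show "((\<lambda>\<tau>. B * (C * \<tau>) ^ Suc n / fact (Suc n)) has_real_derivative
          C * (B * (C * s) ^ n / fact n)) (at s within {0..T})" for s
      proof -
        have "((\<lambda>\<tau>. B * (C * \<tau>) ^ Suc n / fact (Suc n)) has_real_derivative
            B * (real (Suc n) * C * (C * s) ^ n) / fact (Suc n)) (at s within {0..T})"
          by (auto intro!: derivative_eq_intros simp del: power_Suc of_nat_Suc fact_Suc)
        moreover have "B * (real (Suc n) * C * (C * s) ^ n) / fact (Suc n)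
            = C * (B * (C * s) ^ n / fact n)"
          by (simp add: fact_Suc del: of_nat_Suc)
        ultimately show ?thesis by (simp only:)
      qed
      show "\<bar>w' s i\<bar> \<le> C * (B * (C * s) ^ n / fact n)" if "s \<in> {0..T}" for s
        using lip Suc that by blast
    qed (use Suc deriv init in auto)
  qed
  have "(\<lambda>n. B * ((C * t) ^ n / fact n)) \<longlonglongrightarrow> B * 0"
    using summable_LIMSEQ_zero[OF summable_exp[of "C * t"]]
    by (intro tendsto_mult_left) (simp add: field_simps)
  then have "(\<lambda>n. B * (C * t) ^ n / fact n) \<longlonglongrightarrow> 0" by simp
  then have "\<bar>w t i\<bar> \<le> 0"
    by (rule LIMSEQ_le_const) (use iter assms in auto)
  then show ?thesis by simp
qed

section \<open>Uniqueness\<close>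

lemma yamabe_flow_bound:
  assumes cplx: "simplicial_2_complex V E F" and sol: "yamabe_flow_solution V E F d T u"
    and card: "\<And>i. i \<in> V \<Longrightarrow> card {\<Delta> \<in> F. i \<in> \<Delta>} \<le> n"
    and "i \<in> V" and t: "t \<in> {0..T}"
  shows "\<bar>u t i\<bar> \<le> (2 * pi + n * pi) * T"
proof -
  have "\<bar>u t i\<bar> \<le> (2 * pi + n * pi) * t"
  proof (rule abs_le_of_derivative_bound[OF _ _ _ _ _ t])
    show "((\<lambda>\<tau>. u \<tau> i) has_real_derivative - curvature F (u s \<^bold>* d) i) (at s within {0..T})"
      if "s \<in> {0..T}" for s
      using sol \<open>i \<in> V\<close> that by (simp add: yamabe_flow_solution_def)
    show "((*) (2 * pi + n * pi) has_real_derivative 2 * pi + n * pi) (at s within {0..T})" for s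
      by (auto intro!: derivative_eq_intros)
    show "\<bar>- curvature F (u s \<^bold>* d) i\<bar> \<le> 2 * pi + n * pi" if "s \<in> {0..T}" for s
      using curvature_bound[OF cplx _ card[OF \<open>i \<in> V\<close>], of "u s \<^bold>* d"] sol that
      by (simp add: yamabe_flow_solution_def)
    show "u 0 i = 0" using sol \<open>i \<in> V\<close> by (simp add: yamabe_flow_solution_def)
  qed simp
  also have "\<dots> \<le> (2 * pi + n * pi) * T" using t by (intro mult_left_mono) auto
  finally show ?thesis .
qed

theorem theorem1p3:
  fixes V :: "'a set" and E F :: "'a set set" and S :: "'b topology"
    and M :: nat and d :: "'a set \<Rightarrow> real" and T \<epsilon> :: real
    and u u' :: "real \<Rightarrow> 'a \<Rightarrow> real"
  assumes "surface S"
    and "triangulation_of V E F S"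
    and "infinite V"
    and "locally_finite V E F"
    and "without_boundary E F"
    and "\<forall>i\<in>V. vertex_degree E i \<le> M"
    and "PL_metric E F d"
    and "uniformly_nondegenerate F d"
    and "\<exists>\<delta>>0. uniformly_Delaunay F d \<delta>"
    and "T > 0"
    and "yamabe_flow_solution V E F d T u"
    and "yamabe_flow_solution V E F d T u'"
    and "\<epsilon> > 0"
    and "\<forall>t\<in>{0..T}. \<forall>s\<in>{0..1}.
           PL_metric E F ((\<lambda>i. s * u t i + (1 - s) * u' t i) \<^bold>* d) \<and>
           uniformly_Delaunay F ((\<lambda>i. s * u t i + (1 - s) * u' t i) \<^bold>* d) \<epsilon>"
  shows "\<forall>t\<in>{0..T}. \<forall>i\<in>V. u t i = u' t i"
proof -
  have cplx: "simplicial_2_complex V E F"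
    using \<open>triangulation_of V E F S\<close> by (simp add: triangulation_of_def)
  note sol = \<open>yamabe_flow_solution V E F d T u\<close> and sol' = \<open>yamabe_flow_solution V E F d T u'\<close>
  have card: "card {\<Delta> \<in> F. i \<in> \<Delta>} \<le> 2 * M" if "i \<in> V" for i
    using card_faces_at_vertex[OF cplx assms(4,5) that] assms(6) that by blast
  define N where "N = (2 * pi + (2 * M) * pi) * T"
  have N: "\<bar>u t i\<bar> \<le> N" "\<bar>u' t i\<bar> \<le> N" if "i \<in> V" "t \<in> {0..T}" for t i
    unfolding N_def using yamabe_flow_bound[OF cplx sol card that]
      yamabe_flow_bound[OF cplx sol' card that] by simp_all
  \<comment> \<open>The two solutions are the endpoints \<open>s = 1\<close> and \<open>s = 0\<close> of the segment.\<close>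
  have good: "PL_metric E F (u t \<^bold>* d)" "uniformly_Delaunay F (u t \<^bold>* d) \<epsilon>"
    "PL_metric E F (u' t \<^bold>* d)" "uniformly_Delaunay F (u' t \<^bold>* d) \<epsilon>" if "t \<in> {0..T}" for t
    using assms(14)[rule_format, OF that, of 1] assms(14)[rule_format, OF that, of 0] by simp_all
  obtain L where "0 \<le> L" and
    L: "\<And>t D i j k. \<lbrakk>t \<in> {0..T}; {i, j, k} \<in> F; \<And>v. v \<in> V \<Longrightarrow> \<bar>u t v - u' t v\<bar> \<le> D\<rbrakk> \<Longrightarrow>
      \<bar>inner_angle (u t \<^bold>* d) i {j, k} - inner_angle (u' t \<^bold>* d) i {j, k}\<bar> \<le> L * D"
  proof (rule conformal_angle_lipschitz[OF cplx assms(5,7,8,13), of N], goal_cases)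
    case (1 L)
    then show ?case using good N by blast
  qed
  have "u t i - u' t i = 0" if "i \<in> V" "t \<in> {0..T}" for t i
  proof (rule uniform_gronwall_zero[where I = V and T = T and B = "2 * N" and C = "2 * M * L"
        and w = "\<lambda>t i. u t i - u' t i"
        and w' = "\<lambda>t i. - curvature F (u t \<^bold>* d) i - - curvature F (u' t \<^bold>* d) i"])
    fix i t assume it: "i \<in> V" "t \<in> {0..T}"
    show "((\<lambda>\<tau>. u \<tau> i - u' \<tau> i) has_real_derivative
        - curvature F (u t \<^bold>* d) i - - curvature F (u' t \<^bold>* d) i) (at t within {0..T})"
      using it sol sol' by (intro DERIV_diff) (auto simp: yamabe_flow_solution_def)
    show "\<bar>u t i - u' t i\<bar> \<le> 2 * N" using N[OF it] by linarith
    fix D assume D: "\<And>j. j \<in> V \<Longrightarrow> \<bar>u t j - u' t j\<bar> \<le> D"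
    have "0 \<le> D" using D[OF it(1)] by linarith
    then have "\<bar>curvature F (u t \<^bold>* d) i - curvature F (u' t \<^bold>* d) i\<bar> \<le> real (2 * M) * (L * D)"
      using \<open>0 \<le> L\<close> L[OF it(2) _ D]
      by (intro curvature_diff_le[OF cplx card[OF it(1)]]) auto
    then show "\<bar>- curvature F (u t \<^bold>* d) i - - curvature F (u' t \<^bold>* d) i\<bar> \<le> 2 * M * L * D"
      by (simp add: abs_minus_commute mult.assoc)
  next
    show "u 0 i - u' 0 i = 0" if "i \<in> V" for i
      using sol sol' that by (simp add: yamabe_flow_solution_def)
  qed (use that in auto)
  then show ?thesis by simp
qed

end
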